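(* Let $x$ and $t$ be formal variables. For $n\ge 1$ let $\mathcal{SF}_n^2$ be the set of permutations $\sigma=\sigma_1\cdots\sigma_{3n}$ of $\{1,\ldots,3n\}$ such that $\sigma_{3i-2}<\sigma_{3i-1}$ and $\sigma_{3i-2}<\sigma_{3i}$ for every $i=1,\ldots,n$, and let $\mathrm{ris}(\sigma)=|\{i\in\{1,\dots,3n-1\}:\sigma_i<\sigma_{i+1}\}|$. Then, as formal power series, $$\mathcal{R}(x,t):=1+\sum_{n\ge1}\frac{t^{3n}}{(3n)!}\sum_{\sigma\in\mathcal{SF}_n^2}x^{\mathrm{ris}(\sigma)}=\frac{1-x}{1-x+\sum_{n\ge1}\frac{(x(x-1)t^3)^n}{(3n)!}\prod_{k=1}^n(x+3k-2)}.$$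
   Context: $\mathcal{SF}_n^2$ is exactly the set of permutations $\sigma_F$ associated with forests $F=(F_1,\ldots,F_n)$ of $n$ binary shrubs labeled by $\{1,\dots,3n\}$: a binary shrub is a root with an ordered pair of children (left, right), labeled so the root's label is smaller than both children's labels; $\sigma_{F_i}$ lists root, left child, right child, and $\sigma_F$ is the concatenation $\sigma_{F_1}\cdots\sigma_{F_n}$. *)

theory Defs
  imports
    "HOL-Computational_Algebra.Computational_Algebra"
    "HOL-Combinatorics.Permutations"
begin

definition SF2 :: "nat \<Rightarrow> (nat \<Rightarrow> nat) set" where
  "SF2 n = {\<sigma>. \<sigma> permutes {1..3 * n} \<and>
     (\<forall>i\<in>{1..n}. \<sigma> (3 * i - 2) < \<sigma> (3 * i - 1) \<and> \<sigma> (3 * i - 2) < \<sigma> (3 * i))}"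

text \<open>The first argument is the length of the one-line word of the permutation.\<close>

definition ris :: "nat \<Rightarrow> (nat \<Rightarrow> nat) \<Rightarrow> nat" where
  "ris m \<sigma> = card {i \<in> {1..m - 1}. \<sigma> i < \<sigma> (i + 1)}"

text \<open>
  The ambient ring is \<open>\<rat>(x)\<lbrakk>t\<rbrakk>\<close>: the constant coefficient \<open>1 - x\<close> of the denominator
  is not a unit in \<open>\<rat>[x]\<close>, so the quotient is formed over the field of
  rational functions in \<open>x\<close>.
\<close>

type_synonym ratfun = "rat poly fract"

definition var_x :: "ratfun fps" where
  "var_x = fps_const (Fraction_Field.Fract [:0, 1:] 1)"

abbreviation var_t :: "ratfun fps" where
  "var_t \<equiv> fps_X"

text \<open>
  Infinite sums are \<^const>\<open>suminf\<close> in the \<open>t\<close>-adic topology; sums over \<open>n \<ge> 1\<close> are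
  written with the summand at \<open>Suc n\<close>. The lemmas below show that the series on both sides
  of the identity converge.
\<close>

definition R :: "ratfun fps" where
  "R = 1 + (\<Sum>n. var_t ^ (3 * Suc n) / fact (3 * Suc n) *
     (\<Sum>\<sigma>\<in>SF2 (Suc n). var_x ^ ris (3 * Suc n) \<sigma>))"

lemma fps_summable_X_power_3:
  fixes f :: "nat \<Rightarrow> 'a::comm_ring_1 fps"
  assumes "\<And>n. f n = fps_X ^ (3 * n) * g n"
  shows "summable (\<lambda>n. f (Suc n))"
proof -
  have z: "f n $ k = 0" if "k < n" for n k
    using that by (simp add: assms fps_X_power_mult_nth)
  have "(\<lambda>n. f (Suc n)) sums Abs_fps (\<lambda>k. \<Sum>i<k. f (Suc i) $ k)"
    unfolding sums_def
  proof (rule tendsto_fpsI)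
    fix k
    show "\<forall>\<^sub>F n in sequentially.
        (\<Sum>i<n. f (Suc i)) $ k = Abs_fps (\<lambda>k. \<Sum>i<k. f (Suc i) $ k) $ k"
    proof (rule eventually_sequentiallyI[of k])
      fix n assume "k \<le> n"
      then have "(\<Sum>i<n. f (Suc i) $ k) = (\<Sum>i<k. f (Suc i) $ k)"
        by (intro sum.mono_neutral_right) (auto simp: z)
      then show "(\<Sum>i<n. f (Suc i)) $ k = Abs_fps (\<lambda>k. \<Sum>i<k. f (Suc i) $ k) $ k"
        by (simp add: fps_sum_nth)
    qed
  qed
  then show ?thesis by (rule sums_summable)
qed

lemma fps_divide_fact:
  "(a :: ratfun fps) / fact m = a * fps_const (inverse (fact m))"
proof -
  have "(fact m :: ratfun fps) = fps_const (fact m)"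
    by (metis fps_of_nat of_nat_fact)
  then show ?thesis
    by (simp add: fps_divide_unit fps_const_inverse)
qed

lemma summable_R:
  "summable (\<lambda>n. var_t ^ (3 * Suc n) / fact (3 * Suc n) *
     (\<Sum>\<sigma>\<in>SF2 (Suc n). var_x ^ ris (3 * Suc n) \<sigma>))"
  by (rule fps_summable_X_power_3[where g = "\<lambda>n. fps_const (inverse (fact (3 * n))) *
        (\<Sum>\<sigma>\<in>SF2 n. var_x ^ ris (3 * n) \<sigma>)"
        and f = "\<lambda>n. var_t ^ (3 * n) / fact (3 * n) * (\<Sum>\<sigma>\<in>SF2 n. var_x ^ ris (3 * n) \<sigma>)"])
     (simp only: fps_divide_fact mult.assoc)

lemma summable_denominator:
  "summable (\<lambda>n. (var_x * (var_x - 1) * var_t ^ 3) ^ Suc n / fact (3 * Suc n) *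
     (\<Prod>k=1..Suc n. var_x + 3 * of_nat k - 2))"
  by (rule fps_summable_X_power_3[where g = "\<lambda>n. (var_x * (var_x - 1)) ^ n *
        fps_const (inverse (fact (3 * n))) * (\<Prod>k=1..n. var_x + 3 * of_nat k - 2)"
        and f = "\<lambda>n. (var_x * (var_x - 1) * var_t ^ 3) ^ n / fact (3 * n) *
        (\<Prod>k=1..n. var_x + 3 * of_nat k - 2)"])
     (simp only: fps_divide_fact power_mult_distrib power_mult mult.assoc mult.left_commute)

end

theory Submission
  imports Defs
begin

text \<open>
  Inside a shrub the root is followed by a rise, so only the comparison of the two children and
  the comparison of a right child with the next root are free. Writing the weight \<open>x\<close> of a rise
  of the second kind as \<open>1 + (x - 1)\<close> marks some of these rises; maximal runs of marked rises
  cut the word into chains, in which every right child is smaller than the next root. Splitting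
  off the first chain gives, with \<open>A n\<close> the rise polynomial of \<open>n\<close> shrubs and \<open>C m\<close> that of a
  chain of \<open>m\<close> shrubs without the marked rises,
  \<open>A n = (\<Sum>m=1..n. (3n choose 3m) * (x - 1)^(m-1) * C m * A (n-m))\<close>.
  In a chain the first root is the minimum; either its left child is the second smallest label
  and its right child the third (weight \<open>x\<^sup>2\<close>), or its right child is the second smallest label
  and its left child is any of the other \<open>3m - 2\<close> labels (weight \<open>x\<close>). Hence
  \<open>C m = x * (x + 3m - 2) * C (m-1)\<close>.
\<close>

section \<open>Rises of words and the decomposition of words into shrubs\<close>

fun rises :: "'a::linorder list \<Rightarrow> nat" where
  "rises (a # b # w) = (if a < b then 1 else 0) + rises (b # w)"
| "rises _ = 0"

lemma rises_eq_card: "rises w = card {i. Suc i < length w \<and> w ! i < w ! Suc i}"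
proof (induction w rule: rises.induct)
  case (1 a b w)
  let ?I = "\<lambda>w. {i. Suc i < length w \<and> w ! i < w ! Suc i}"
  have fin: "finite (?I (b # w))"
    by (rule finite_subset[of _ "{..<length (b # w)}"]) auto
  have "?I (a # b # w) = (if a < b then {0} else {}) \<union> Suc ` ?I (b # w)"
  proof (rule set_eqI)
    fix i
    show "i \<in> ?I (a # b # w) \<longleftrightarrow> i \<in> (if a < b then {0} else {}) \<union> Suc ` ?I (b # w)"
      by (cases i) auto
  qed
  also have "card \<dots> = (if a < b then 1 else 0) + card (?I (b # w))"
    using fin by (subst card_Un_disjoint) (auto simp: card_image)
  finally show ?case using 1 by simp
qed auto

text \<open>Any label set is allowed, since splitting off a shrub leaves gaps in the labels.
  Positions count from 0, whereas \<open>SF2\<close> counts from 1.\<close>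

definition shrub_words :: "nat \<Rightarrow> nat set \<Rightarrow> nat list set" where
  "shrub_words n S = {w. set w = S \<and> distinct w \<and> length w = 3 * n \<and>
     (\<forall>i<n. w ! (3 * i) < w ! (3 * i + 1) \<and> w ! (3 * i) < w ! (3 * i + 2))}"

text \<open>A shrub is a triple (root, left child, right child).\<close>

definition shrubs :: "nat set \<Rightarrow> (nat \<times> nat \<times> nat) set" where
  "shrubs S = {(a, b, c). a \<in> S \<and> b \<in> S \<and> c \<in> S \<and> a < b \<and> a < c \<and> b \<noteq> c}"

lemma finite_shrubs [simp]: "finite S \<Longrightarrow> finite (shrubs S)"
  by (rule finite_subset[of _ "S \<times> S \<times> S"]) (auto simp: shrubs_def)

lemma finite_shrub_words [simp]: "finite S \<Longrightarrow> finite (shrub_words n S)"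
  by (rule finite_subset[OF _ finite_lists_length_eq[of S "3 * n"]])
     (auto simp: shrub_words_def)

lemma card_remove_shrub:
  "(a, b, c) \<in> shrubs S \<Longrightarrow> card S = 3 * Suc n \<Longrightarrow> card (S - {a, b, c}) = 3 * n"
  by (subst card_Diff_subset) (auto simp: shrubs_def)

lemma shrub_words_0: "shrub_words 0 {} = {[]}"
  by (auto simp: shrub_words_def)

lemma Cons3_in_shrub_words_iff:
  "a # b # c # w \<in> shrub_words (Suc n) S \<longleftrightarrow>
     (a, b, c) \<in> shrubs S \<and> w \<in> shrub_words n (S - {a, b, c})"
  by (auto simp: shrub_words_def shrubs_def All_less_Suc2)

lemma bij_betw_shrub_words_Suc:
  "bij_betw (\<lambda>((a, b, c), w). a # b # c # w)
     (SIGMA (a, b, c) : shrubs S. shrub_words n (S - {a, b, c})) (shrub_words (Suc n) S)"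
proof (rule bij_betwI')
  fix w assume w: "w \<in> shrub_words (Suc n) S"
  then have "length w = Suc (Suc (Suc (3 * n)))" by (simp add: shrub_words_def)
  then obtain a b c v where "w = a # b # c # v" by (auto simp: length_Suc_conv)
  with w show "\<exists>y\<in>SIGMA (a, b, c):shrubs S. shrub_words n (S - {a, b, c}).
      w = (\<lambda>((a, b, c), w). a # b # c # w) y"
    by (intro bexI[of _ "((a, b, c), v)"]) (auto simp: Cons3_in_shrub_words_iff)
qed (auto simp: Cons3_in_shrub_words_iff)

lemma sum_shrub_words_Suc:
  fixes f :: "nat list \<Rightarrow> 'a::comm_monoid_add"
  assumes "finite S"
  shows "(\<Sum>w\<in>shrub_words (Suc n) S. f w) =
    (\<Sum>(a, b, c)\<in>shrubs S. \<Sum>w\<in>shrub_words n (S - {a, b, c}). f (a # b # c # w))"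
proof -
  have "(\<Sum>w\<in>shrub_words (Suc n) S. f w) =
     (\<Sum>y\<in>(SIGMA (a, b, c) : shrubs S. shrub_words n (S - {a, b, c})).
        f ((\<lambda>((a, b, c), w). a # b # c # w) y))"
    by (rule sum.reindex_bij_betw[symmetric, OF bij_betw_shrub_words_Suc])
  also have "\<dots> = (\<Sum>t\<in>shrubs S. \<Sum>w\<in>(case t of (a, b, c) \<Rightarrow> shrub_words n (S - {a, b, c})).
        f ((\<lambda>((a, b, c), w). a # b # c # w) (t, w)))"
    using assms by (subst sum.Sigma) (auto simp: split_def)
  also have "\<dots> = (\<Sum>(a, b, c)\<in>shrubs S. \<Sum>w\<in>shrub_words n (S - {a, b, c}). f (a # b # c # w))"
    by (rule sum.cong) auto
  finally show ?thesis .
qed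

text \<open>Double counting: choosing a label set and then a shrub in it amounts to choosing the
  shrub first and then the remaining labels.\<close>

lemma sum_subsets_shrubs:
  fixes f :: "nat \<times> nat \<times> nat \<Rightarrow> nat set \<Rightarrow> 'a::comm_monoid_add"
  assumes "finite S"
  shows "(\<Sum>T | T \<subseteq> S \<and> card T = 3 * Suc m. \<Sum>(a, b, c)\<in>shrubs T. f (a, b, c) (T - {a, b, c})) =
    (\<Sum>(a, b, c)\<in>shrubs S. \<Sum>T | T \<subseteq> S - {a, b, c} \<and> card T = 3 * m. f (a, b, c) T)"
proof -
  let ?e = "\<lambda>(a, b, c). {a, b, c :: nat}"
  have fT: "finite T" if "T \<subseteq> S" for T using assms that finite_subset by blast
  have "(\<Sum>T | T \<subseteq> S \<and> card T = 3 * Suc m. \<Sum>t\<in>shrubs T. f t (T - ?e t)) =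
     (\<Sum>(T, t)\<in>(SIGMA T : {T. T \<subseteq> S \<and> card T = 3 * Suc m}. shrubs T). f t (T - ?e t))"
    using assms fT by (intro sum.Sigma) auto
  also have "\<dots> = (\<Sum>(t, T)\<in>(SIGMA t : shrubs S. {T. T \<subseteq> S - ?e t \<and> card T = 3 * m}). f t T)"
  proof (rule sum.reindex_bij_witness[where i = "\<lambda>(t, T). (T \<union> ?e t, t)"
        and j = "\<lambda>(T, t). (t, T - ?e t)"], goal_cases)
    case (2 y)
    then show ?case by (auto simp: card_remove_shrub) (auto simp: shrubs_def)
  next
    case (4 y)
    then obtain a b c T where y: "y = ((a, b, c), T)" and t: "(a, b, c) \<in> shrubs S"
      and T: "T \<subseteq> S - {a, b, c}" "card T = 3 * m" by auto
    have "card (T \<union> {a, b, c}) = 3 * Suc m"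
      using T t fT[of T] by (subst card_Un_disjoint) (auto simp: shrubs_def)
    with y t T show ?case by (auto simp: shrubs_def)
  qed (auto simp: shrubs_def)
  also have "\<dots> = (\<Sum>t\<in>shrubs S. \<Sum>T | T \<subseteq> S - ?e t \<and> card T = 3 * m. f t T)"
    using assms by (intro sum.Sigma[symmetric]) auto
  finally show ?thesis by (simp add: split_def)
qed

section \<open>Marked rises and chains\<close>

context
  fixes x :: "'a::comm_ring_1"
begin

definition rise_sum :: "nat \<Rightarrow> nat set \<Rightarrow> 'a" where
  "rise_sum n S = (\<Sum>w\<in>shrub_words n S. x ^ rises w)"

text \<open>The empty word has no first root that could form a rise with \<open>p\<close>, hence
  contributes 0.\<close>

definition rise_sum_above :: "nat \<Rightarrow> nat set \<Rightarrow> nat \<Rightarrow> 'a" where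
  "rise_sum_above n S p = (\<Sum>w\<in>shrub_words n S. if w \<noteq> [] \<and> p < hd w then x ^ rises w else 0)"

text \<open>The unconditional factor \<open>x\<close> is the rise from root to left child. The rise
  from \<open>p\<close> to \<open>a\<close> is only required here; its mark \<open>x - 1\<close> is
  accounted for separately.\<close>

definition shrub_weight :: "nat \<Rightarrow> nat \<Rightarrow> nat \<Rightarrow> nat \<Rightarrow> 'a" where
  "shrub_weight p a b c = (if p < a then x * (if b < c then x else 1) else 0)"

text \<open>
  Here \<open>p\<close> is the right child preceding the chain; \<open>p = 0\<close> means that the chain comes first,
  as all labels are positive.
\<close>

primrec chain_sum :: "nat \<Rightarrow> nat set \<Rightarrow> nat \<Rightarrow> 'a" where
  "chain_sum 0 T p = 1"
| "chain_sum (Suc m) T p =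
    (\<Sum>(a, b, c)\<in>shrubs T. shrub_weight p a b c * chain_sum m (T - {a, b, c}) c)"

text \<open>A chain followed by an arbitrary word on the remaining labels. Their junction is
  unmarked and has weight 1 whether or not it is a rise.\<close>

definition marked_sum :: "nat \<Rightarrow> nat \<Rightarrow> nat set \<Rightarrow> nat \<Rightarrow> 'a" where
  "marked_sum m n S p = (\<Sum>T | T \<subseteq> S \<and> card T = 3 * m. chain_sum m T p * rise_sum n (S - T))"

lemma rise_sum_0 [simp]: "rise_sum 0 {} = 1"
  by (simp add: rise_sum_def shrub_words_0)

text \<open>A virtual letter 0 before the word lies below every root. For \<open>n = 0\<close> the
  empty word would break the equality.\<close>

lemma rise_sum_eq_above_0:
  assumes "0 \<notin> S" "n > 0"
  shows "rise_sum n S = rise_sum_above n S 0"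
  unfolding rise_sum_def rise_sum_above_def
proof (rule sum.cong)
  fix w assume "w \<in> shrub_words n S"
  then have "set w = S" "w \<noteq> []" using assms by (auto simp: shrub_words_def)
  then have "0 < hd w" using assms hd_in_set by (metis gr0I)
  then show "x ^ rises w = (if w \<noteq> [] \<and> 0 < hd w then x ^ rises w else 0)"
    using \<open>w \<noteq> []\<close> by simp
qed simp

text \<open>This is where marking enters: a rise from \<open>p\<close> to the next root has weight
  \<open>x = 1 + (x - 1)\<close>, any other junction has weight 1.\<close>

lemma sum_rises_Cons:
  "(\<Sum>w\<in>shrub_words n S. x ^ rises (p # w)) = rise_sum n S + (x - 1) * rise_sum_above n S p"
proof -
  have "x ^ rises (p # w) = x ^ rises w + (x - 1) * (if w \<noteq> [] \<and> p < hd w then x ^ rises w else 0)"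
    for w by (cases w) (auto simp: algebra_simps)
  then show ?thesis
    by (simp add: rise_sum_def rise_sum_above_def sum.distrib sum_distrib_left)
qed

lemma rise_sum_above_Suc:
  assumes "finite S"
  shows "rise_sum_above (Suc n) S p = (\<Sum>(a, b, c)\<in>shrubs S. shrub_weight p a b c *
    (rise_sum n (S - {a, b, c}) + (x - 1) * rise_sum_above n (S - {a, b, c}) c))"
proof -
  have "(if p < a then x ^ rises (a # b # c # w) else 0) = shrub_weight p a b c * x ^ rises (c # w)"
    if "(a, b, c) \<in> shrubs S" for a b c w
    using that by (auto simp: shrub_weight_def shrubs_def algebra_simps)
  then show ?thesis
    unfolding rise_sum_above_def[of "Suc n"] sum_shrub_words_Suc[OF assms]
    by (intro sum.cong) (auto simp: sum_rises_Cons[symmetric] sum_distrib_left)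
qed

lemma marked_sum_0:
  assumes "finite S"
  shows "marked_sum 0 n S p = rise_sum n S"
proof -
  have "{T. T \<subseteq> S \<and> card T = 3 * 0} = {{}}"
    using assms by (auto simp: finite_subset)
  then show ?thesis by (simp add: marked_sum_def)
qed

text \<open>The first shrub of the chain is chosen before the rest of the chain's label set, by
  \<open>sum_subsets_shrubs\<close>.\<close>

lemma marked_sum_Suc:
  assumes "finite S"
  shows "marked_sum (Suc m) n S p =
    (\<Sum>(a, b, c)\<in>shrubs S. shrub_weight p a b c * marked_sum m n (S - {a, b, c}) c)"
proof -
  define f where "f = (\<lambda>(a, b, c) T. shrub_weight p a b c * (chain_sum m T c *
    rise_sum n (S - {a, b, c} - T)))"
  have S: "S - T = S - {a, b, c} - (T - {a, b, c})" if "(a, b, c) \<in> shrubs T" for a b c T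
    using that by (auto simp: shrubs_def)
  have "marked_sum (Suc m) n S p =
     (\<Sum>T | T \<subseteq> S \<and> card T = 3 * Suc m. \<Sum>(a, b, c)\<in>shrubs T. f (a, b, c) (T - {a, b, c}))"
    unfolding marked_sum_def chain_sum.simps sum_distrib_right
    by (intro sum.cong refl) (auto simp: f_def S mult.assoc)
  also have "\<dots> = (\<Sum>(a, b, c)\<in>shrubs S. \<Sum>T | T \<subseteq> S - {a, b, c} \<and> card T = 3 * m. f (a, b, c) T)"
    by (rule sum_subsets_shrubs[OF assms])
  also have "\<dots> = (\<Sum>(a, b, c)\<in>shrubs S. shrub_weight p a b c * marked_sum m n (S - {a, b, c}) c)"
    by (intro sum.cong refl) (auto simp: f_def marked_sum_def sum_distrib_left)
  finally show ?thesis .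
qed

text \<open>Unrolling \<open>rise_sum_above_Suc\<close>: after each shrub the chain either stops or
  continues across a marked rise. The index \<open>m\<close> counts the marked rises, so the chain
  has \<open>Suc m\<close> shrubs.\<close>

lemma rise_sum_above_eq_marked_sum:
  assumes "finite S"
  shows "rise_sum_above (Suc n) S p = (\<Sum>m\<le>n. (x - 1) ^ m * marked_sum (Suc m) (n - m) S p)"
  using assms
proof (induction n arbitrary: S p)
  case 0
  then show ?case
    by (simp add: rise_sum_above_Suc marked_sum_Suc marked_sum_0)
       (simp add: rise_sum_above_def shrub_words_def)
next
  case (Suc n)
  \<comment> \<open>The term \<open>m = 0\<close> is the chain that stops here; the others come from
    the induction hypothesis, shifted by one.\<close>
  have *: "rise_sum (Suc n) T + (x - 1) * rise_sum_above (Suc n) T c =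
      (\<Sum>m\<le>Suc n. (x - 1) ^ m * marked_sum m (Suc n - m) T c)" if "finite T" for T c
    using that by (subst sum.atMost_Suc_shift) (simp add: Suc marked_sum_0 sum_distrib_left mult.assoc)
  have "rise_sum_above (Suc (Suc n)) S p = (\<Sum>(a, b, c)\<in>shrubs S. \<Sum>m\<le>Suc n.
      shrub_weight p a b c * ((x - 1) ^ m * marked_sum m (Suc n - m) (S - {a, b, c}) c))"
    using Suc.prems by (subst rise_sum_above_Suc) (simp_all only: * finite_Diff sum_distrib_left)
  also have "\<dots> = (\<Sum>m\<le>Suc n. \<Sum>(a, b, c)\<in>shrubs S.
      shrub_weight p a b c * ((x - 1) ^ m * marked_sum m (Suc n - m) (S - {a, b, c}) c))"
    unfolding split_def by (rule sum.swap)
  also have "\<dots> = (\<Sum>m\<le>Suc n. (x - 1) ^ m * marked_sum (Suc m) (Suc n - m) S p)"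
    using Suc.prems
    by (intro sum.cong refl) (auto simp: marked_sum_Suc sum_distrib_left split_def mult_ac)
  finally show ?case .
qed

section \<open>Evaluation of chain sums\<close>

text \<open>All labels in a chain exceed \<open>p\<close>, because its roots and right children
  increase from \<open>p\<close> on. A label \<open>q \<le> p\<close> can thus never be placed: it
  survives the removal of each shrub.\<close>

lemma chain_sum_eq_0:
  assumes "card T = 3 * m" "finite T" "q \<in> T" "q \<le> p"
  shows "chain_sum m T p = 0"
  using assms
proof (induction m arbitrary: T p)
  case (Suc m)
  have "shrub_weight p a b c * chain_sum m (T - {a, b, c}) c = 0" if t: "(a, b, c) \<in> shrubs T" for a b c
  proof (cases "p < a")
    case True
    then have "q \<in> T - {a, b, c}" "q \<le> c" using t Suc.prems by (auto simp: shrubs_def)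
    then have "chain_sum m (T - {a, b, c}) c = 0"
      using card_remove_shrub[OF t Suc.prems(1)] Suc.prems by (intro Suc.IH) auto
    then show ?thesis by simp
  qed (simp add: shrub_weight_def)
  then show ?case by (auto intro!: sum.neutral)
qed auto

text \<open>By \<open>chain_sum_eq_0\<close> a first shrub counts only if every label left over
  exceeds its right child, which leaves the two cases for the smallest labels.\<close>

lemma chain_sum_eq:
  assumes "card T = 3 * m" "finite T" "\<And>q. q \<in> T \<Longrightarrow> p < q"
  shows "chain_sum m T p = x ^ m * (\<Prod>k=1..m. x + 3 * of_nat k - 2)"
  using assms
proof (induction m arbitrary: T p)
  case (Suc m)
  define C where "C = x ^ m * (\<Prod>k=1..m. x + 3 * of_nat k - 2)"
  \<comment> \<open>The three smallest labels are \<open>a < u < v\<close>, and \<open>V\<close> is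
    everything above \<open>u\<close>.\<close>
  define a where "a = Min T"
  define u where "u = Min (T - {a})"
  define v where "v = Min (T - {a} - {u})"
  define V where "V = T - {a} - {u}"
  have ne: "T \<noteq> {}" using Suc.prems(1) by auto
  have a: "a \<in> T" "\<And>q. q \<in> T \<Longrightarrow> a \<le> q" using ne Suc.prems by (auto simp: a_def)
  have c1: "card (T - {a}) = 3 * m + 2" using a Suc.prems by simp
  then have ne1: "T - {a} \<noteq> {}" by (metis add_is_0 card.empty zero_neq_numeral)
  have u: "u \<in> T - {a}" "\<And>q. q \<in> T - {a} \<Longrightarrow> u \<le> q"
    using Min_in[OF _ ne1] Suc.prems by (auto simp: u_def)
  have c2: "card V = 3 * m + 1" using c1 u Suc.prems by (simp add: V_def)
  then have ne2: "V \<noteq> {}" by (metis add_is_0 card.empty one_neq_zero)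
  have v: "v \<in> V" "\<And>q. q \<in> V \<Longrightarrow> v \<le> q"
    using Min_in[OF _ ne2] Suc.prems by (auto simp: v_def V_def)
  have au: "a < u" using a(2)[of u] u(1) by auto
  have uV: "u < q" if "q \<in> V" for q using u(2)[of q] that by (auto simp: V_def order.strict_iff_order)
  have aV: "a < q" if "q \<in> V" for q using au uV[OF that] by simp
  let ?f = "\<lambda>(a, b, c). shrub_weight p a b c * chain_sum m (T - {a, b, c}) c"
  \<comment> \<open>The surviving first shrubs: children \<open>u\<close>, \<open>v\<close> in this
    order, or right child \<open>u\<close> with any left child from \<open>V\<close>.\<close>
  let ?G = "insert (a, u, v) ((\<lambda>b. (a, b, u)) ` V)"
  have "chain_sum (Suc m) T p = sum ?f (shrubs T)" by simp
  also have "\<dots> = sum ?f ?G"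
  proof (rule sum.mono_neutral_right)
    show "?G \<subseteq> shrubs T"
      using a(1) u(1) v(1) au uV aV unfolding V_def by (auto simp: shrubs_def)
    show "\<forall>t\<in>shrubs T - ?G. ?f t = 0"
    proof
      fix y assume y: "y \<in> shrubs T - ?G"
      obtain a' b c where yeq: "y = (a', b, c)" by (cases y)
      with y have t: "(a', b, c) \<in> shrubs T" and n: "(a', b, c) \<notin> (\<lambda>b. (a, b, u)) ` V"
        and n': "(a', b, c) \<noteq> (a, u, v)" by auto
      have "\<exists>q\<in>T - {a', b, c}. q \<le> c"
      proof (rule ccontr)
        assume "\<not> ?thesis"
        then have g: "\<And>q. q \<in> T \<Longrightarrow> q \<le> c \<Longrightarrow> q = a' \<or> q = b \<or> q = c" by auto
        have "a = a'" using g[of a] a t by (auto simp: shrubs_def dest: leD)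
        with t have bc: "b \<in> T - {a}" "c \<in> T - {a}" "b \<noteq> c" by (auto simp: shrubs_def)
        then have "u = b \<or> u = c" using g[of u] u \<open>a = a'\<close> by auto
        then show False
        proof
          assume "u = c"
          with bc \<open>a = a'\<close> n show False by (auto simp: V_def)
        next
          assume "u = b"
          with bc have "c \<in> V" by (auto simp: V_def)
          with g[of v] v have "v = c" using \<open>u = b\<close> \<open>a = a'\<close> by (auto simp: V_def)
          with \<open>u = b\<close> \<open>a = a'\<close> n' show False by simp
        qed
      qed
      then obtain q where "q \<in> T - {a', b, c}" "q \<le> c" by blast
      then have "chain_sum m (T - {a', b, c}) c = 0"
        using card_remove_shrub[OF t Suc.prems(1)] Suc.prems by (intro chain_sum_eq_0) auto
      then show "?f y = 0" by (simp add: yeq)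
    qed
  qed (use Suc.prems in auto)
  also have "\<dots> = ?f (a, u, v) + (\<Sum>b\<in>V. ?f (a, b, u))"
    using Suc.prems uV v(1) by (subst sum.insert) (auto simp: V_def sum.reindex inj_on_def)
  also have "?f (a, u, v) = x * x * C"
  proof -
    have t: "(a, u, v) \<in> shrubs T" using a(1) u(1) v(1) au uV aV unfolding V_def by (auto simp: shrubs_def)
    have "v < q" if "q \<in> T - {a, u, v}" for q
      using v(2)[of q] that by (auto simp: V_def order.strict_iff_order)
    then have "chain_sum m (T - {a, u, v}) v = C"
      unfolding C_def using card_remove_shrub[OF t Suc.prems(1)] Suc.prems(2) by (intro Suc.IH) auto
    then show ?thesis using uV[OF v(1)] Suc.prems(3)[OF a(1)] by (simp add: shrub_weight_def)
  qed
  also have "(\<Sum>b\<in>V. ?f (a, b, u)) = (\<Sum>b\<in>V. x * C)"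
  proof (rule sum.cong)
    fix b assume b: "b \<in> V"
    have t: "(a, b, u) \<in> shrubs T"
      using a(1) u(1) b au uV[OF b] aV[OF b] by (auto simp: shrubs_def V_def)
    have "u < q" if "q \<in> T - {a, b, u}" for q
      using uV[of q] that by (auto simp: V_def)
    then have "chain_sum m (T - {a, b, u}) u = C"
      unfolding C_def using card_remove_shrub[OF t Suc.prems(1)] Suc.prems(2) by (intro Suc.IH) auto
    then show "?f (a, b, u) = x * C"
      using uV[OF b] Suc.prems(3)[OF a(1)] by (simp add: shrub_weight_def)
  qed simp
  \<comment> \<open>Since \<open>card V = 3 * m + 1 = 3 * Suc m - 2\<close>, the two cases add up to
    the new factor.\<close>
  also have "x * x * C + (\<Sum>b\<in>V. x * C) = x ^ Suc m * (\<Prod>k=1..Suc m. x + 3 * of_nat k - 2)"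
    by (simp add: c2 C_def algebra_simps)
  finally show ?case .
qed simp

section \<open>The recurrence for the rise polynomials\<close>

text \<open>The binomial coefficient counts the label sets of the first chain. Keeping the smaller
  values abstract as \<open>r\<close> lets the recurrence serve inside the induction that proves
  their dependence on the size alone.\<close>

lemma rise_sum_recurrence:
  assumes "finite S" "card S = 3 * Suc n" "0 \<notin> S"
    and "\<And>m T. m \<le> n \<Longrightarrow> T \<subseteq> S \<Longrightarrow> card T = 3 * m \<Longrightarrow> rise_sum m T = r m"
  shows "rise_sum (Suc n) S = (\<Sum>m\<le>n. (x - 1) ^ m * (of_nat (3 * Suc n choose (3 * Suc m)) *
    (x ^ Suc m * (\<Prod>k=1..Suc m. x + 3 * of_nat k - 2)) * r (n - m)))"
proof -
  have "marked_sum (Suc m) (n - m) S 0 = of_nat (3 * Suc n choose (3 * Suc m)) *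
      (x ^ Suc m * (\<Prod>k=1..Suc m. x + 3 * of_nat k - 2)) * r (n - m)" if m: "m \<le> n" for m
  proof -
    have "marked_sum (Suc m) (n - m) S 0 = (\<Sum>T | T \<subseteq> S \<and> card T = 3 * Suc m.
       (x ^ Suc m * (\<Prod>k=1..Suc m. x + 3 * of_nat k - 2)) * r (n - m))"
      unfolding marked_sum_def
    proof (intro sum.cong refl arg_cong2[where f = times])
      fix T assume "T \<in> {T. T \<subseteq> S \<and> card T = 3 * Suc m}"
      then have T: "T \<subseteq> S" "card T = 3 * Suc m" "finite T"
        using assms(1) finite_subset by auto
      show "chain_sum (Suc m) T 0 = x ^ Suc m * (\<Prod>k=1..Suc m. x + 3 * of_nat k - 2)"
        using T assms(3) by (intro chain_sum_eq) (auto intro: gr0I)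
      show "rise_sum (n - m) (S - T) = r (n - m)"
        using T assms(1,2) m by (intro assms(4)) (auto simp: card_Diff_subset)
    qed
    then show ?thesis using n_subsets[OF assms(1), of "3 * Suc m"] assms(2) by simp
  qed
  then show ?thesis
    using assms(1,3) by (simp add: rise_sum_eq_above_0 rise_sum_above_eq_marked_sum)
qed

text \<open>Both sides obey the same recurrence with the same smaller values, so words need not be
  relabelled.\<close>

lemma rise_sum_eq_interval:
  assumes "finite S" "card S = 3 * n" "0 \<notin> S"
  shows "rise_sum n S = rise_sum n {1..3 * n}"
  using assms
proof (induction n arbitrary: S rule: less_induct)
  case (less n)
  show ?case
  proof (cases n)
    case 0
    with less.prems show ?thesis by simp
  next
    case (Suc k)
    \<comment> \<open>The set \<open>U\<close> stands for both \<open>S\<close> and the interval, as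
      the recurrence is applied on both sides.\<close>
    have "rise_sum m T = rise_sum m {1..3 * m}"
      if "m \<le> k" "T \<subseteq> U" "card T = 3 * m" "finite U" "0 \<notin> U" for m T U
      using that Suc by (intro less.IH) (auto intro: finite_subset)
    then show ?thesis using less.prems unfolding Suc
      by (subst (1 2) rise_sum_recurrence[where r = "\<lambda>m. rise_sum m {1..3 * m}"]) auto
  qed
qed

end

section \<open>Permutations as one-line words\<close>

lemma bij_betw_permutes_words:
  "bij_betw (\<lambda>\<sigma>. map \<sigma> [1..<Suc m]) {\<sigma>. \<sigma> permutes {1..m}} {w. distinct w \<and> set w = {1..m}}"
proof (rule bij_betwI')
  fix \<sigma> \<tau> :: "nat \<Rightarrow> nat"
  assume st: "\<sigma> \<in> {\<sigma>. \<sigma> permutes {1..m}}" "\<tau> \<in> {\<sigma>. \<sigma> permutes {1..m}}"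
  show "(map \<sigma> [1..<Suc m] = map \<tau> [1..<Suc m]) = (\<sigma> = \<tau>)"
  proof
    assume "map \<sigma> [1..<Suc m] = map \<tau> [1..<Suc m]"
    then have "\<sigma> i = \<tau> i" if "i \<in> {1..m}" for i
      using that by (auto simp: map_eq_conv simp del: upt_Suc)
    then show "\<sigma> = \<tau>" using st by (metis ext mem_Collect_eq permutes_not_in)
  qed simp
next
  fix \<sigma> :: "nat \<Rightarrow> nat" assume s: "\<sigma> \<in> {\<sigma>. \<sigma> permutes {1..m}}"
  then have "set (map \<sigma> [1..<Suc m]) = {1..m}"
    using permutes_image[of \<sigma> "{1..m}"] by (simp add: atLeastLessThanSuc_atLeastAtMost del: upt_Suc)
  moreover have "distinct (map \<sigma> [1..<Suc m])"
    using s by (auto simp: distinct_map permutes_inj_on simp del: upt_Suc)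
  ultimately show "map \<sigma> [1..<Suc m] \<in> {w. distinct w \<and> set w = {1..m}}" by blast
next
  fix w assume w: "w \<in> {w. distinct w \<and> set w = {1..m}}"
  then have len: "length w = m" using distinct_card[of w] by auto
  \<comment> \<open>The permutation is read off the word, with positions shifted by one, and fixes
    everything outside the interval.\<close>
  define \<sigma> where "\<sigma> i = (if i \<in> {1..m} then w ! (i - 1) else i)" for i
  have "map \<sigma> [1..<Suc m] = w"
    by (rule nth_equalityI) (auto simp: len \<sigma>_def simp del: upt_Suc)
  moreover have "\<sigma> permutes {1..m}"
  proof (rule bij_imp_permutes)
    show "bij_betw \<sigma> {1..m} {1..m}"
    proof (rule bij_betw_imageI)
      show "inj_on \<sigma> {1..m}"
        using w len by (auto simp: inj_on_def \<sigma>_def nth_eq_iff_index_eq)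
      have "\<sigma> ` {1..m} = set (map \<sigma> [1..<Suc m])"
        by (simp add: atLeastLessThanSuc_atLeastAtMost del: upt_Suc)
      also have "\<dots> = {1..m}" unfolding \<open>map \<sigma> [1..<Suc m] = w\<close> using w by simp
      finally show "\<sigma> ` {1..m} = {1..m}" .
    qed
  qed (auto simp: \<sigma>_def)
  ultimately show "\<exists>\<sigma>\<in>{\<sigma>. \<sigma> permutes {1..m}}. w = map \<sigma> [1..<Suc m]" by auto
qed

lemma rises_map_eq_ris: "rises (map \<sigma> [1..<Suc m]) = ris m \<sigma>"
proof -
  have "bij_betw Suc {i. Suc i < m \<and> \<sigma> (Suc i) < \<sigma> (Suc (Suc i))}
     {i \<in> {1..m - 1}. \<sigma> i < \<sigma> (i + 1)}"
  proof (rule bij_betw_imageI)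
    show "Suc ` {i. Suc i < m \<and> \<sigma> (Suc i) < \<sigma> (Suc (Suc i))} = {i \<in> {1..m - 1}. \<sigma> i < \<sigma> (i + 1)}"
      (is "_ = ?R")
    proof (intro equalityI subsetI)
      fix i assume "i \<in> ?R"
      then show "i \<in> Suc ` {i. Suc i < m \<and> \<sigma> (Suc i) < \<sigma> (Suc (Suc i))}" by (cases i) auto
    qed auto
  qed simp
  from bij_betw_same_card[OF this] show ?thesis
    by (simp add: rises_eq_card ris_def del: upt_Suc cong: conj_cong)
qed

lemma map_in_shrub_words_iff:
  assumes "\<sigma> permutes {1..3 * n}"
  shows "map \<sigma> [1..<Suc (3 * n)] \<in> shrub_words n {1..3 * n} \<longleftrightarrow> \<sigma> \<in> SF2 n"
proof -
  have "map \<sigma> [1..<Suc (3 * n)] \<in> {w. distinct w \<and> set w = {1..3 * n}}"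
    using bij_betw_apply[OF bij_betw_permutes_words, of \<sigma> "3 * n"] assms by simp
  moreover have "(\<forall>i\<in>{1..n}. \<sigma> (3 * i - 2) < \<sigma> (3 * i - 1) \<and> \<sigma> (3 * i - 2) < \<sigma> (3 * i)) \<longleftrightarrow>
      (\<forall>i<n. \<sigma> (Suc (3 * i)) < \<sigma> (Suc (Suc (3 * i))) \<and>
        \<sigma> (Suc (3 * i)) < \<sigma> (Suc (Suc (Suc (3 * i)))))"
    unfolding image_Suc_lessThan[symmetric] by (auto simp: eval_nat_numeral)
  ultimately show ?thesis
    using assms by (simp add: shrub_words_def SF2_def nth_append del: upt_Suc)
qed

lemma sum_SF2_eq_rise_sum: "(\<Sum>\<sigma>\<in>SF2 n. x ^ ris (3 * n) \<sigma>) = rise_sum x n {1..3 * n}"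
proof -
  have "bij_betw (\<lambda>\<sigma>. map \<sigma> [1..<Suc (3 * n)]) (SF2 n) (shrub_words n {1..3 * n})"
  proof -
    have "(\<lambda>\<sigma>. map \<sigma> [1..<Suc (3 * n)]) ` SF2 n = shrub_words n {1..3 * n}"
    proof (intro equalityI subsetI)
      fix w assume w: "w \<in> shrub_words n {1..3 * n}"
      then have "w \<in> {w. distinct w \<and> set w = {1..3 * n}}" by (simp add: shrub_words_def)
      then obtain \<sigma> where "\<sigma> permutes {1..3 * n}" "w = map \<sigma> [1..<Suc (3 * n)]"
        unfolding bij_betw_imp_surj_on[OF bij_betw_permutes_words, symmetric] by blast
      with w show "w \<in> (\<lambda>\<sigma>. map \<sigma> [1..<Suc (3 * n)]) ` SF2 n"
        using map_in_shrub_words_iff by blast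
    next
      fix w assume "w \<in> (\<lambda>\<sigma>. map \<sigma> [1..<Suc (3 * n)]) ` SF2 n"
      then obtain \<sigma> where \<sigma>: "\<sigma> \<in> SF2 n" "w = map \<sigma> [1..<Suc (3 * n)]" by blast
      then have "\<sigma> permutes {1..3 * n}" by (simp add: SF2_def)
      with \<sigma> show "w \<in> shrub_words n {1..3 * n}" by (simp only: map_in_shrub_words_iff)
    qed
    then show ?thesis
      by (intro bij_betw_subset[OF bij_betw_permutes_words]) (auto simp: SF2_def)
  qed
  from sum.reindex_bij_betw[OF this, of "\<lambda>w. x ^ rises w"] show ?thesis
    by (simp only: rises_map_eq_ris rise_sum_def)
qed

section \<open>Generating functions\<close>

text \<open>Turns the infinite sums into ordinary series with \<open>fps_X ^ 3\<close> substituted,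
  so that the identity can be checked coefficientwise in the cube of the variable.\<close>

lemma suminf_fps_X_power_3:
  fixes c :: "nat \<Rightarrow> 'a::comm_ring_1"
  shows "fps_const (c 0) + (\<Sum>n. fps_const (c (Suc n)) * fps_X ^ (3 * Suc n)) =
    Abs_fps c oo fps_X ^ 3"
proof -
  have "(\<lambda>n. fps_const (c (Suc n)) * fps_X ^ (3 * Suc n)) sums
      ((Abs_fps c oo fps_X ^ 3) - fps_const (c 0))"
    unfolding sums_def
  proof (rule tendsto_fpsI)
    fix k
    show "\<forall>\<^sub>F n in sequentially. (\<Sum>i<n. fps_const (c (Suc i)) * fps_X ^ (3 * Suc i)) $ k =
        ((Abs_fps c oo fps_X ^ 3) - fps_const (c 0)) $ k"
    proof (rule eventually_sequentiallyI[of k])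
      fix n assume "k \<le> n"
      have "(\<Sum>i<n. fps_const (c (Suc i)) * fps_X ^ (3 * Suc i)) $ k =
          (\<Sum>i<n. if k = 3 * Suc i then c (Suc i) else 0)"
        unfolding fps_sum_nth fps_mult_left_const_nth fps_X_power_nth by (intro sum.cong) auto
      \<comment> \<open>Only \<open>i = k div 3 - 1\<close> can contribute, and
        \<open>k \<le> n\<close> puts it in range.\<close>
      also have "\<dots> = (\<Sum>i\<in>(if 3 dvd k \<and> k > 0 then {k div 3 - 1} else {}). c (Suc i))"
        using \<open>k \<le> n\<close> unfolding sum.inter_filter[OF finite_lessThan, symmetric]
        by (intro sum.cong) (auto elim!: dvdE)
      also have "\<dots> = ((Abs_fps c oo fps_X ^ 3) - fps_const (c 0)) $ k"
        by (auto simp: fps_nth_compose_X_power elim!: dvdE)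
      finally show "(\<Sum>i<n. fps_const (c (Suc i)) * fps_X ^ (3 * Suc i)) $ k =
        ((Abs_fps c oo fps_X ^ 3) - fps_const (c 0)) $ k" .
    qed
  qed
  then show ?thesis by (simp add: sums_unique[symmetric])
qed

lemma fps_const_sum: "fps_const (sum f A) = (\<Sum>i\<in>A. fps_const (f i))"
  by (rule fps_ext) (simp add: fps_sum_nth)

lemma fps_const_prod: "fps_const (prod f A) = (\<Prod>i\<in>A. fps_const (f i))"
  by (induction A rule: infinite_finite_induct) (simp_all flip: fps_const_mult)

definition shrub_coeff :: "'a::field_char_0 \<Rightarrow> nat \<Rightarrow> 'a" where
  "shrub_coeff x n = rise_sum x n {1..3 * n} / fact (3 * n)"

text \<open>The general formula would give 1 at \<open>n = 0\<close>, where the denominator has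
  \<open>1 - x\<close>.\<close>

definition denom_coeff :: "'a::field_char_0 \<Rightarrow> nat \<Rightarrow> 'a" where
  "denom_coeff x n = (if n = 0 then 1 - x
     else (x * (x - 1)) ^ n / fact (3 * n) * (\<Prod>k=1..n. x + 3 * of_nat k - 2))"

text \<open>The recurrence divided by the factorial and multiplied by \<open>1 - x\<close>: as
  \<open>(1 - x) * (x - 1) ^ m = - ((x - 1) ^ Suc m)\<close>, it says that every higher coefficient
  of the product vanishes.\<close>

lemma shrub_coeff_mult_denom_coeff:
  fixes x :: "'a::field_char_0"
  shows "Abs_fps (shrub_coeff x) * Abs_fps (denom_coeff x) = fps_const (1 - x)"
proof (rule fps_ext)
  fix n
  show "(Abs_fps (shrub_coeff x) * Abs_fps (denom_coeff x)) $ n = fps_const (1 - x) $ n"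
  proof (cases n)
    case 0
    then show ?thesis by (simp add: shrub_coeff_def denom_coeff_def)
  next
    case (Suc N)
    define P where "P m = (\<Prod>k=1..m. x + 3 * of_nat k - 2)" for m
    have binom: "of_nat (3 * Suc N choose (3 * Suc m)) =
        fact (3 * Suc N) / (fact (3 * Suc m) * fact (3 * (N - m)) :: 'a)" if "m \<le> N" for m
      using binomial_fact[of "3 * Suc m" "3 * Suc N", where 'a = 'a] that
      by (simp add: diff_mult_distrib2 del: fact_Suc)
    have "rise_sum x (Suc N) {1..3 * Suc N} = (\<Sum>m\<le>N. (x - 1) ^ m *
        (of_nat (3 * Suc N choose (3 * Suc m)) * (x ^ Suc m * P (Suc m)) *
          rise_sum x (N - m) {1..3 * (N - m)}))"
      unfolding P_def
    proof (rule rise_sum_recurrence)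
      fix m T assume T: "T \<subseteq> {1..3 * Suc N}" "card T = 3 * m"
      show "rise_sum x m T = rise_sum x m {1..3 * m}"
      proof (rule rise_sum_eq_interval)
        show "finite T" using T(1) finite_subset by blast
      qed (use T in auto)
    qed auto
    then have "(1 - x) * shrub_coeff x (Suc N) = (\<Sum>m\<le>N. (1 - x) * ((x - 1) ^ m *
        (of_nat (3 * Suc N choose (3 * Suc m)) * (x ^ Suc m * P (Suc m)) *
          rise_sum x (N - m) {1..3 * (N - m)})) / fact (3 * Suc N))"
      by (simp only: shrub_coeff_def sum_distrib_left sum_divide_distrib times_divide_eq_right)
    also have "\<dots> = (\<Sum>m\<le>N. - (denom_coeff x (Suc m) * shrub_coeff x (N - m)))"
    proof (rule sum.cong)
      fix m assume m: "m \<in> {..N}"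
      \<comment> \<open>Variables replace factorials, powers and products so that they are treated
        as atoms.\<close>
      have "(1 - x) * ((x - 1) ^ m * (F / (G * H) * (X * p) * s)) / F =
          - ((x - 1) ^ Suc m * X / G * p * (s / H))"
        if "F \<noteq> 0" "G \<noteq> 0" "H \<noteq> 0" for F G H X p s :: 'a
        using that by (simp add: field_simps)
      then have "(1 - x) * ((x - 1) ^ m * (of_nat (3 * Suc N choose (3 * Suc m)) *
          (x ^ Suc m * P (Suc m)) * rise_sum x (N - m) {1..3 * (N - m)})) / fact (3 * Suc N) =
          - ((x - 1) ^ Suc m * x ^ Suc m / fact (3 * Suc m) * P (Suc m) *
            (rise_sum x (N - m) {1..3 * (N - m)} / fact (3 * (N - m))))"
        using m by (simp only: binom atMost_iff fact_nonzero not_False_eq_True)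
      then show "(1 - x) * ((x - 1) ^ m * (of_nat (3 * Suc N choose (3 * Suc m)) *
          (x ^ Suc m * P (Suc m)) * rise_sum x (N - m) {1..3 * (N - m)})) / fact (3 * Suc N) =
          - (denom_coeff x (Suc m) * shrub_coeff x (N - m))"
        by (simp only: denom_coeff_def shrub_coeff_def P_def power_mult_distrib mult_ac if_False nat.simps)
    qed simp
    finally have "(1 - x) * shrub_coeff x (Suc N) +
        (\<Sum>m\<le>N. denom_coeff x (Suc m) * shrub_coeff x (N - m)) = 0"
      by (simp add: sum_negf)
    moreover have "(Abs_fps (denom_coeff x) * Abs_fps (shrub_coeff x)) $ Suc N =
        (1 - x) * shrub_coeff x (Suc N) +
        (\<Sum>m\<le>N. denom_coeff x (Suc m) * shrub_coeff x (N - m))"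
      unfolding fps_mult_nth atLeast0AtMost
      by (subst sum.atMost_Suc_shift) (simp add: denom_coeff_def)
    ultimately show ?thesis by (simp add: Suc mult.commute)
  qed
qed

theorem theorem1:
  shows "R = (1 - var_x) /
    (1 - var_x + (\<Sum>n. (var_x * (var_x - 1) * var_t ^ 3) ^ Suc n / fact (3 * Suc n) *
       (\<Prod>k=1..Suc n. var_x + 3 * of_nat k - 2)))"
proof -
  define x :: ratfun where "x = Fraction_Field.Fract [:0, 1:] 1"
  have var_x: "var_x = fps_const x" by (simp add: var_x_def x_def)
  have "x \<noteq> 1" by (simp add: x_def One_fract_def eq_fract one_pCons)
  have R: "R = Abs_fps (shrub_coeff x) oo fps_X ^ 3"
  proof -
    have "var_t ^ (3 * Suc n) / fact (3 * Suc n) * (\<Sum>\<sigma>\<in>SF2 (Suc n). var_x ^ ris (3 * Suc n) \<sigma>) =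
        fps_const (shrub_coeff x (Suc n)) * fps_X ^ (3 * Suc n)" for n
      unfolding var_x fps_const_power fps_const_sum[symmetric] sum_SF2_eq_rise_sum
        fps_divide_fact shrub_coeff_def divide_inverse fps_const_mult[symmetric]
      by (simp only: mult_ac)
    moreover have "shrub_coeff x 0 = 1" by (simp add: shrub_coeff_def)
    ultimately show ?thesis
      unfolding R_def suminf_fps_X_power_3[symmetric] by simp
  qed
  have "1 - var_x + (\<Sum>n. (var_x * (var_x - 1) * var_t ^ 3) ^ Suc n / fact (3 * Suc n) *
       (\<Prod>k=1..Suc n. var_x + 3 * of_nat k - 2)) = Abs_fps (denom_coeff x) oo fps_X ^ 3"
    (is "?D = _")
  proof -
    have lin: "var_x + 3 * of_nat k - 2 = fps_const (x + 3 * of_nat k - 2)" for k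
      by (simp only: var_x numeral_fps_const fps_of_nat[symmetric] fps_const_add fps_const_sub
        fps_const_mult)
    have "(var_x * (var_x - 1) * var_t ^ 3) ^ Suc n / fact (3 * Suc n) *
        (\<Prod>k=1..Suc n. var_x + 3 * of_nat k - 2) =
        fps_const (denom_coeff x (Suc n)) * fps_X ^ (3 * Suc n)" for n
    proof -
      have d: "denom_coeff x (Suc n) = (x * (x - 1)) ^ Suc n * inverse (fact (3 * Suc n)) *
          (\<Prod>k=1..Suc n. x + 3 * of_nat k - 2)"
        by (simp only: denom_coeff_def divide_inverse nat.simps if_False)
      have "var_x * (var_x - 1) = fps_const (x * (x - 1))"
        unfolding var_x by (simp flip: fps_const_1_eq_1)
      then show ?thesis
        unfolding d lin fps_const_prod[symmetric] fps_divide_fact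
          power_mult_distrib[of _ "var_t ^ 3"] power_mult[symmetric] fps_const_mult[symmetric]
          fps_const_power[symmetric]
        by (simp only: mult_ac)
    qed
    moreover have "fps_const (denom_coeff x 0) = 1 - var_x"
      by (simp add: denom_coeff_def var_x flip: fps_const_sub)
    ultimately show ?thesis
      unfolding suminf_fps_X_power_3[symmetric] by simp
  qed
  \<comment> \<open>Substituting \<open>fps_X ^ 3\<close> is multiplicative.\<close>
  then have "R * ?D = (Abs_fps (shrub_coeff x) * Abs_fps (denom_coeff x)) oo fps_X ^ 3"
    by (simp only: R) (simp add: fps_compose_mult_distrib)
  then have RD: "R * ?D = 1 - var_x"
    by (simp only: shrub_coeff_mult_denom_coeff fps_const_compose)
       (simp only: var_x fps_const_sub[symmetric] fps_const_1_eq_1)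
  \<comment> \<open>A nonzero product forces \<open>?D\<close> to be nonzero, which permits
    cancelling it in the quotient.\<close>
  moreover have "1 - var_x \<noteq> 0"
    using \<open>x \<noteq> 1\<close> by (auto simp: var_x fps_eq_iff intro!: exI[of _ 0])
  ultimately have "?D \<noteq> 0" by auto
  from nonzero_mult_div_cancel_right[OF this, of R] show ?thesis
    unfolding RD by (rule sym)
qed

end
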